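(* Let $(a(n))_{n\ge1}$ be the sequence defined by $a(1)=2$ and, for $n\ge2$, $a(n)=a(n-1)+4$ if $n\in\{a(k):1\le k<n\}$ and $a(n)=a(n-1)+2$ otherwise. Then for every $n\ge1$, \[ -3< a(n)-(1+\sqrt3)\,n<2. \]
   Context: This sequence is the $(0,2,4,2)$-hiccup sequence (OEIS A284753), which begins $2,6,8,10,12,16,18,22,24,28,\ldots$. *)

theory Defs
  imports Complex_Main
begin

text \<open>
  The sequence is indexed from 1; the value at 0 is a dummy, and the membership test
  ranges only over indices \<open>1 \<le> k < n\<close>.
\<close>

function hiccup :: "nat \<Rightarrow> nat" where
  "hiccup n =
     (if n = 0 then 0
      else if n = 1 then 2
      else if n \<in> hiccup ` {1..<n} then hiccup (n - 1) + 4
      else hiccup (n - 1) + 2)"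
  by auto
termination by (relation "measure id") auto

declare hiccup.simps [simp del]

lemma hiccup_1: "hiccup 1 = 2"
  by (simp add: hiccup.simps)

lemma hiccup_rec:
  assumes "n \<ge> 2"
  shows "hiccup n = (if n \<in> {hiccup k | k. 1 \<le> k \<and> k < n}
                     then hiccup (n - 1) + 4 else hiccup (n - 1) + 2)"
proof -
  have "{hiccup k | k. 1 \<le> k \<and> k < n} = hiccup ` {1..<n}"
    by auto
  with assms show ?thesis
    by (subst hiccup.simps) simp
qed

end

theory Submission
  imports Defs
begin

text \<open>
  Write \<open>a\<close> for the sequence, with \<open>a(0) = 0\<close>, put \<open>D(n) = a(n) - (1 + \<surd>3) n\<close> and \<open>t = \<surd>3 - 1\<close>.
  If \<open>k\<close> terms are at most \<open>n\<close>, then \<open>a(n) = 2n + 2k\<close>, and so \<open>n = a(k) + j\<close> gives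
  \<open>D(n) = t (- D(k) - j)\<close>. If the gap \<open>a(k+1) - a(k)\<close> is 2, then \<open>j \<le> 1\<close>. If it is 4, then \<open>j \<le> 3\<close>,
  but \<open>k + 1 = a(i)\<close> for some \<open>i\<close>, whence \<open>D(k+1) = - t D(i)\<close> and
  \<open>D(n) = t (t D(i) + 2 - t - j)\<close>. Both maps preserve the open interval from \<open>- (1 + \<surd>3)\<close> to 2.
\<close>

lemma hiccup_0 [simp]: "hiccup 0 = 0"
  by (simp add: hiccup.simps)

lemma hiccup_Suc:
  "hiccup (Suc n) = (if Suc n \<in> hiccup ` {1..n} then hiccup n + 4 else hiccup n + 2)"
  by (subst hiccup.simps) (auto simp: atLeastLessThanSuc_atLeastAtMost)

lemma strict_mono_hiccup: "strict_mono hiccup"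
  by (simp add: strict_mono_Suc_iff hiccup_Suc)

lemma hiccup_ge: "2 * n \<le> hiccup n"
  by (induction n) (auto simp: hiccup_Suc)

text \<open>Every step adds 2, and 2 more exactly when the new index is a term; \<open>k\<close>
  counts these indices.\<close>

lemma hiccup_eq_counting:
  "\<exists>k. hiccup k \<le> n \<and> n < hiccup (Suc k) \<and> hiccup n = 2 * n + 2 * k"
proof (induction n)
  case 0
  show ?case
    by (rule exI[of _ 0]) (simp add: hiccup_Suc)
next
  case (Suc n)
  then obtain k where k: "hiccup k \<le> n" "n < hiccup (Suc k)" "hiccup n = 2 * n + 2 * k"
    by blast
  show ?case
  proof (cases "hiccup (Suc k) = Suc n")
    case True
    \<comment> \<open>The membership test sees only earlier indices, so \<open>Suc k \<le> n\<close>
      is required.\<close>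
    then have "Suc k \<in> {1..n}"
      using hiccup_ge[of "Suc k"] by simp
    then have "Suc n \<in> hiccup ` {1..n}"
      using True by (metis image_eqI)
    then have "hiccup (Suc n) = hiccup n + 4"
      by (simp add: hiccup_Suc)
    moreover have "Suc n < hiccup (Suc (Suc k))"
      using True strict_mono_hiccup by (metis lessI strict_mono_less)
    ultimately show ?thesis
      using True k by (intro exI[of _ "Suc k"]) simp
  next
    case False
    have "Suc n \<notin> hiccup ` {1..n}"
    proof
      assume "Suc n \<in> hiccup ` {1..n}"
      then obtain m where m: "hiccup m = Suc n"
        by auto
      then have "hiccup k < hiccup m" "hiccup m < hiccup (Suc k)"
        using k False by simp_all
      then show False
        using strict_mono_hiccup by (simp add: strict_mono_less)
    qed
    then have "hiccup (Suc n) = hiccup n + 2"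
      by (simp add: hiccup_Suc)
    then show ?thesis
      using False k by (intro exI[of _ k]) simp
  qed
qed

lemma hiccup_hiccup: "hiccup (hiccup i) = 2 * hiccup i + 2 * i"
proof -
  obtain k where k: "hiccup k \<le> hiccup i" "hiccup i < hiccup (Suc k)"
      "hiccup (hiccup i) = 2 * hiccup i + 2 * k"
    using hiccup_eq_counting by blast
  then have "k = i"
    using strict_mono_hiccup by (simp add: strict_mono_less strict_mono_less_eq)
  then show ?thesis
    using k by simp
qed

definition discrepancy :: "nat \<Rightarrow> real" where
  "discrepancy n = real (hiccup n) - (1 + sqrt 3) * real n"

text \<open>The factorization rests on \<open>(sqrt 3 - 1) * (sqrt 3 + 1) = 2\<close>.\<close>

lemma discrepancy_add:
  assumes "hiccup (hiccup k + j) = 2 * (hiccup k + j) + 2 * k"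
  shows "discrepancy (hiccup k + j) = (sqrt 3 - 1) * (- discrepancy k - real j)"
  unfolding discrepancy_def assms by (simp add: algebra_simps)

text \<open>The endpoints 2 and \<open>- (1 + sqrt 3)\<close> are the fixed points of the gap-4 map
  for \<open>j = 0\<close> and \<open>j = 3\<close>.\<close>

lemma discrepancy_bounds: "- (1 + sqrt 3) < discrepancy n \<and> discrepancy n < 2"
proof (induction n rule: less_induct)
  case (less n)
  define s where "s = sqrt (3::real)"
  have s2: "s * s = 3" and s: "1.7 < s" "s < 2"
    unfolding s_def by (simp, rule real_less_rsqrt, simp add: power2_eq_square,
        rule real_less_lsqrt, simp_all)
  \<comment> \<open>Multiplying by \<open>s - 1\<close> in advance leaves goals that are linear once
    \<open>s * s = 3\<close>.\<close>
  have IH: "0 < (s - 1) * (discrepancy m + (1 + s))" "0 < (s - 1) * (2 - discrepancy m)"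
    if "m < n" for m
    using less.IH[OF that] s by (simp_all add: s_def)
  obtain k where k: "hiccup k \<le> n" "n < hiccup (Suc k)" "hiccup n = 2 * n + 2 * k"
    using hiccup_eq_counting by blast
  define j where "j = n - hiccup k"
  have n: "n = hiccup k + j"
    using k by (simp add: j_def)
  have Dn: "discrepancy n = (s - 1) * (- discrepancy k - real j)"
    using discrepancy_add[of k j] k n by (simp add: s_def)
  show ?case
  proof (cases "n = 0")
    case True
    then show ?thesis
      using s by (simp add: discrepancy_def flip: s_def)
  next
    case False
    then have "k < n"
      using k(1) hiccup_ge[of k] by linarith
    show ?thesis
    proof (cases "Suc k \<in> hiccup ` {1..k}")
      \<comment> \<open>With \<open>j = 3\<close>, the bound \<open>discrepancy k < 2\<close> would
        give only \<open>-5 * (s - 1)\<close>, which is too low; hence the passage to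
        \<open>i\<close>.\<close>
      case True
      then obtain i where i: "hiccup i = Suc k" "i \<le> k"
        by auto
      have "discrepancy (Suc k) = (s - 1) * (- discrepancy i)"
        using discrepancy_add[of i 0] hiccup_hiccup[of i] i by (simp add: s_def)
      moreover have "discrepancy (Suc k) = discrepancy k + 3 - s"
        using True by (simp add: discrepancy_def hiccup_Suc algebra_simps flip: s_def)
      ultimately have Dk: "- discrepancy k = (s - 1) * discrepancy i + 3 - s"
        by (simp add: algebra_simps)
      have "(s - 1) * ((s - 1) * (discrepancy i + (1 + s))) > 0"
        "(s - 1) * ((s - 1) * (2 - discrepancy i)) > 0"
        using IH[of i] i \<open>k < n\<close> s by (simp_all only: mult_pos_pos)
      moreover have "0 \<le> (s - 1) * real j" "0 \<le> (s - 1) * (3 - real j)"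
        using True k n s by (auto simp: hiccup_Suc)
      ultimately show ?thesis
        unfolding Dn Dk s_def[symmetric] using s2
        by (simp add: algebra_simps)
    next
      case False
      have "0 \<le> (s - 1) * real j" "0 \<le> (s - 1) * (1 - real j)"
        using False k n s by (auto simp: hiccup_Suc)
      then show ?thesis
        unfolding Dn s_def[symmetric] using IH[OF \<open>k < n\<close>] s2 s
        by (simp add: algebra_simps)
    qed
  qed
qed

theorem theorem17:
  fixes n :: nat
  assumes "n \<ge> 1"
  shows "- 3 < real (hiccup n) - (1 + sqrt 3) * real n
       \<and> real (hiccup n) - (1 + sqrt 3) * real n < 2"
proof -
  have "sqrt 3 < (2::real)"
    by (rule real_less_lsqrt) simp_all
  then show ?thesis
    using discrepancy_bounds[of n] by (simp add: discrepancy_def)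
qed

end
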